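(* Let $H(t)=H_0+V(t)$ be a time-dependent Hamiltonian in a Hilbert space $\mathcal{H}$ with $H_0$ a probe operator and $V$ periodic with period $T$, and let $U_F=U(T,0)$ be the Floquet operator. Suppose $\xi_1,\dots,\xi_n$ are eigenvectors of $U_F$ lying in $\mathrm{dom}\,H_0$ and that the maps $t\mapsto\xi_j(t)=U(t,0)\xi_j$ are $C^1$. Then for every $\psi=\sum_{j=1}^na_j\xi_j$ with $a_j\in\mathbb{C}$, $j=1,\dots,n$, the function $t\mapsto E_\psi(t)$ is bounded. If, moreover, the $V(t)$ are bounded operators and $\sup_t\|V(t)\|<\infty$, then $t\mapsto E_\psi^0(t)$ is also bounded.
   Context: $\mathcal{H}$ is a separable complex Hilbert space and $H(t)$ is a family of self-adjoint operators. A probe operator is an unbounded positive self-adjoint operator with discrete spectrum whose domain is invariant under the time evolution $U(t,0)$. The propagators $U(t,s)$, $t,s\in\mathbb{R}$, form a strongly continuous family of unitary operators with $U(t,r)U(r,s)=U(t,s)$, $U(t,t)=I$, and $\psi(t)=U(t,0)\psi$ is, for $\psi\in\mathrm{dom}\,H_0$, the solution of the Schrödinger equation $i\,\frac{d\psi(t)}{dt}=H(t)\psi(t)$ with $\psi(0)=\psi$ (so $\psi(t)\in\mathrm{dom}\,H(t)$). By periodicity, $U(t+T,r+T)=U(t,r)$. Energy functions: $E_\psi(t)=\langle\psi(t),H(t)\psi(t)\rangle$ and $E_\psi^0(t)=\langle\psi(t),H_0\psi(t)\rangle$. *)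

theory Defs
  imports "HOL-Analysis.Analysis"
begin

text \<open>
  The inner product is conjugate linear in the first and linear in the second argument. The last
  axiom makes it positive definite and ties it to the norm inherited from \<^class>\<open>banach\<close>;
  completeness is also inherited from there. Finite-dimensional and non-separable instances are
  not excluded by the class.
\<close>

class complex_hilbert_space = banach +
  fixes scaleC :: "complex \<Rightarrow> 'a \<Rightarrow> 'a"  (infixr \<open>*\<^sub>C\<close> 75)
    and cinner :: "'a \<Rightarrow> 'a \<Rightarrow> complex"
  assumes scaleC_of_real: "complex_of_real r *\<^sub>C x = r *\<^sub>R x"
    and scaleC_add_right: "c *\<^sub>C (x + y) = c *\<^sub>C x + c *\<^sub>C y"
    and scaleC_add_left: "(c + d) *\<^sub>C x = c *\<^sub>C x + d *\<^sub>C x"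
    and scaleC_scaleC: "c *\<^sub>C d *\<^sub>C x = (c * d) *\<^sub>C x"
    and cinner_commute: "cinner x y = cnj (cinner y x)"
    and cinner_add_right: "cinner x (y + z) = cinner x y + cinner x z"
    and cinner_scaleC_right: "cinner x (c *\<^sub>C y) = c * cinner x y"
    and cinner_self: "cinner x x = complex_of_real ((norm x)\<^sup>2)"

interpretation complex_vector:
  vector_space "scaleC :: complex \<Rightarrow> 'a \<Rightarrow> 'a::complex_hilbert_space"
proof
  show "1 *\<^sub>C x = x" for x :: 'a
    using scaleC_of_real[of 1 x] by simp
qed (simp_all add: scaleC_add_right scaleC_add_left scaleC_scaleC)


text \<open>
  An operator with a domain is a partial function, so that \<^term>\<open>dom A\<close> is its domain,
  \<^term>\<open>the (A x)\<close> its value at \<^term>\<open>x \<in> dom A\<close>, and equality of operators includes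
  equality of the domains.
\<close>

type_synonym 'a operator = "'a \<rightharpoonup> 'a"

definition linear_operator :: "'a::complex_hilbert_space operator \<Rightarrow> bool" where
  "linear_operator A \<longleftrightarrow> complex_vector.subspace (dom A) \<and>
     (\<forall>x\<in>dom A. \<forall>y\<in>dom A. the (A (x + y)) = the (A x) + the (A y)) \<and>
     (\<forall>c. \<forall>x\<in>dom A. the (A (c *\<^sub>C x)) = c *\<^sub>C the (A x))"

definition operator_sum ::
    "'a::complex_hilbert_space operator \<Rightarrow> 'a operator \<Rightarrow> 'a operator" where
  "operator_sum A B =
     (\<lambda>x. if x \<in> dom A \<inter> dom B then Some (the (A x) + the (B x)) else None)"

text \<open>The element chosen by \<open>THE\<close> is unique when \<^term>\<open>A\<close> is densely defined.\<close>

definition adjoint_operator :: "'a::complex_hilbert_space operator \<Rightarrow> 'a operator" where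
  "adjoint_operator A =
     (\<lambda>y. if \<exists>z. \<forall>x\<in>dom A. cinner y (the (A x)) = cinner z x
          then Some (THE z. \<forall>x\<in>dom A. cinner y (the (A x)) = cinner z x) else None)"

definition self_adjoint :: "'a::complex_hilbert_space operator \<Rightarrow> bool" where
  "self_adjoint A \<longleftrightarrow> linear_operator A \<and> closure (dom A) = UNIV \<and> adjoint_operator A = A"

text \<open>Only used for self-adjoint operators, where \<^term>\<open>cinner x (the (A x))\<close> is real.\<close>

definition positive_operator :: "'a::complex_hilbert_space operator \<Rightarrow> bool" where
  "positive_operator A \<longleftrightarrow> (\<forall>x\<in>dom A. 0 \<le> Re (cinner x (the (A x))))"

definition unbounded_operator :: "'a::complex_hilbert_space operator \<Rightarrow> bool" where
  "unbounded_operator A \<longleftrightarrow> \<not> (\<exists>M. \<forall>x\<in>dom A. norm (the (A x)) \<le> M * norm x)"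

definition everywhere_bounded :: "'a::complex_hilbert_space operator \<Rightarrow> bool" where
  "everywhere_bounded A \<longleftrightarrow>
     linear_operator A \<and> dom A = UNIV \<and> bounded_linear (\<lambda>x. the (A x))"

definition resolvent_set :: "'a::complex_hilbert_space operator \<Rightarrow> complex set" where
  "resolvent_set A = {z. bij_betw (\<lambda>x. the (A x) - z *\<^sub>C x) (dom A) UNIV \<and>
     (\<exists>M. \<forall>x\<in>dom A. norm x \<le> M * norm (the (A x) - z *\<^sub>C x))}"

definition spectrum :: "'a::complex_hilbert_space operator \<Rightarrow> complex set" where
  "spectrum A = - resolvent_set A"

definition eigenspace :: "'a::complex_hilbert_space operator \<Rightarrow> complex \<Rightarrow> 'a set" where
  "eigenspace A z = {x \<in> dom A. the (A x) = z *\<^sub>C x}"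

text \<open>
  Discrete spectrum: the whole spectrum consists of isolated points that are eigenvalues of finite
  multiplicity, i.e. the essential spectrum is empty.
\<close>

definition has_discrete_spectrum :: "'a::complex_hilbert_space operator \<Rightarrow> bool" where
  "has_discrete_spectrum A \<longleftrightarrow> (\<forall>z\<in>spectrum A. z isolated_in spectrum A \<and>
     eigenspace A z \<noteq> {0} \<and> (\<exists>B. finite B \<and> eigenspace A z \<subseteq> complex_vector.span B))"

definition unitary :: "('a::complex_hilbert_space \<Rightarrow> 'a) \<Rightarrow> bool" where
  "unitary u \<longleftrightarrow> (\<forall>x y. u (x + y) = u x + u y) \<and> (\<forall>c x. u (c *\<^sub>C x) = c *\<^sub>C u x) \<and>
     surj u \<and> (\<forall>x y. cinner (u x) (u y) = cinner x y)"

definition eigenvector :: "('a::complex_hilbert_space \<Rightarrow> 'a) \<Rightarrow> 'a \<Rightarrow> bool" where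
  "eigenvector u x \<longleftrightarrow> x \<noteq> 0 \<and> (\<exists>c. u x = c *\<^sub>C x)"

definition schroedinger_solution ::
    "(real \<Rightarrow> 'a::complex_hilbert_space operator) \<Rightarrow> (real \<Rightarrow> 'a) \<Rightarrow> bool" where
  "schroedinger_solution H \<psi> \<longleftrightarrow> (\<forall>t. \<psi> t \<in> dom (H t) \<and> \<psi> differentiable (at t) \<and>
     \<i> *\<^sub>C vector_derivative \<psi> (at t) = the (H t (\<psi> t)))"

text \<open>
  \<^term>\<open>U t s\<close> is the propagator from time \<^term>\<open>s\<close> to time \<^term>\<open>t\<close>;
  \<^term>\<open>D\<close> is the set of initial values at time 0 for which the Schroedinger equation holds.
\<close>

definition propagator ::
    "(real \<Rightarrow> 'a::complex_hilbert_space operator) \<Rightarrow> 'a set \<Rightarrow>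
     (real \<Rightarrow> real \<Rightarrow> 'a \<Rightarrow> 'a) \<Rightarrow> bool" where
  "propagator H D U \<longleftrightarrow>
     (\<forall>t s. unitary (U t s)) \<and>
     (\<forall>t r s. U t r \<circ> U r s = U t s) \<and>
     (\<forall>t. U t t = id) \<and>
     (\<forall>x. continuous_on UNIV (\<lambda>(t, s). U t s x)) \<and>
     (\<forall>x\<in>D. schroedinger_solution H (\<lambda>t. U t 0 x))"

definition probe_operator ::
    "(real \<Rightarrow> real \<Rightarrow> 'a \<Rightarrow> 'a) \<Rightarrow> 'a::complex_hilbert_space operator \<Rightarrow> bool" where
  "probe_operator U A \<longleftrightarrow> self_adjoint A \<and> positive_operator A \<and> unbounded_operator A \<and>
     has_discrete_spectrum A \<and> (\<forall>t. U t 0 ` dom A \<subseteq> dom A)"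

definition energy ::
    "(real \<Rightarrow> real \<Rightarrow> 'a \<Rightarrow> 'a) \<Rightarrow> (real \<Rightarrow> 'a::complex_hilbert_space operator) \<Rightarrow> 'a \<Rightarrow>
     real \<Rightarrow> complex" where
  "energy U A \<psi> t = cinner (U t 0 \<psi>) (the (A t (U t 0 \<psi>)))"

end

theory Submission
  imports Defs
begin

text \<open>
  The propagator is not assumed to be periodic. Two solutions of the Schroedinger equation with the
  same initial value agree, because the norm of their difference is conserved. Applied to
  \<open>t \<mapsto> U(t + T, 0)\<xi>\<close> and \<open>t \<mapsto> U(t, 0)(c\<xi>)\<close>, where \<open>U(T, 0)\<xi> = c\<xi>\<close> with \<open>|c| = 1\<close>, this shows that
  a Floquet eigenvector satisfies \<open>\<xi>(t + T) = c\<xi>(t)\<close>. Hence the norm of \<open>\<xi>'\<close> is periodic and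
  continuous, so it is bounded, and \<open>E(t) = \<langle>\<psi>(t), i\<psi>'(t)\<rangle>\<close> is bounded by the Cauchy-Schwarz
  inequality. Subtracting \<open>\<langle>\<psi>(t), V(t)\<psi>(t)\<rangle>\<close> gives the second claim.
\<close>

section \<open>Geometry of the complex inner product\<close>

lemma norm_scaleC: "norm (c *\<^sub>C (x :: 'a::complex_hilbert_space)) = cmod c * norm x"
proof -
  have "cinner (c *\<^sub>C x) (c *\<^sub>C x) = c * cnj (cinner x (c *\<^sub>C x))"
    by (metis cinner_scaleC_right cinner_commute)
  also have "\<dots> = c * cnj c * cnj (cinner x x)"
    by (simp add: cinner_scaleC_right)
  also have "\<dots> = complex_of_real ((cmod c * norm x)\<^sup>2)"
    by (simp add: cinner_self power_mult_distrib complex_norm_square [symmetric])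
  finally have "(norm (c *\<^sub>C x))\<^sup>2 = (cmod c * norm x)\<^sup>2"
    by (simp only: cinner_self of_real_eq_iff)
  then show ?thesis
    by simp
qed

lemma cinner_add_left: "cinner (x + y) z = cinner x z + cinner y z"
  by (metis cinner_add_right cinner_commute complex_cnj_add)

lemma cinner_scaleC_left: "cinner (c *\<^sub>C x) y = cnj c * cinner x y"
  by (metis cinner_scaleC_right cinner_commute complex_cnj_mult)

text \<open>The norm is already a norm by the class, so its triangle inequality is available:
  expanding the square of \<open>norm (x + y)\<close> and comparing with
  \<open>(norm x + norm y)\<^sup>2\<close> leaves exactly this bound.\<close>

lemma Re_cinner_le: "Re (cinner x y) \<le> norm x * norm y"
proof -
  have "cinner (x + y) (x + y) = cinner x x + cinner y y + (cinner x y + cnj (cinner x y))"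
    using cinner_commute [of y x] by (simp add: cinner_add_left cinner_add_right)
  then have "Re (cinner (x + y) (x + y)) = Re (cinner x x) + Re (cinner y y) + 2 * Re (cinner x y)"
    by simp
  then have "(norm (x + y))\<^sup>2 = (norm x)\<^sup>2 + (norm y)\<^sup>2 + 2 * Re (cinner x y)"
    by (simp only: cinner_self Re_complex_of_real)
  moreover have "(norm (x + y))\<^sup>2 \<le> (norm x + norm y)\<^sup>2"
    by (intro power_mono norm_triangle_ineq) simp
  ultimately show ?thesis
    by (simp add: power2_sum)
qed

lemma norm_cinner_le: "cmod (cinner x y) \<le> norm x * norm y"
proof (cases "cinner x y = 0")
  case False
  \<comment> \<open>This phase of modulus 1 rotates the inner product onto the nonnegative real
    axis, which reduces Cauchy-Schwarz to the bound on real parts.\<close>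
  define c where "c = cnj (sgn (cinner x y))"
  have "c * cinner x y = cmod (cinner x y)"
    using False
    by (simp add: c_def sgn_div_norm scaleR_conv_of_real mult.commute divide_simps
        complex_norm_square [symmetric] power2_eq_square)
  then have "cmod (cinner x y) = Re (cinner x (c *\<^sub>C y))"
    by (simp add: cinner_scaleC_right)
  also have "\<dots> \<le> norm x * norm (c *\<^sub>C y)"
    by (rule Re_cinner_le)
  also have "\<dots> = norm x * norm y"
    using False by (simp add: norm_scaleC c_def norm_sgn)
  finally show ?thesis .
qed simp

text \<open>Bilinearity here is over the reals, so conjugation in the first argument does no harm.
  It gives continuity and the product rule for inner products.\<close>

lemma bounded_bilinear_cinner: "bounded_bilinear (cinner :: 'a::complex_hilbert_space \<Rightarrow> _)"
proof
  fix r :: real and x y :: 'a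
  show "cinner (r *\<^sub>R x) y = r *\<^sub>R cinner x y" "cinner x (r *\<^sub>R y) = r *\<^sub>R cinner x y"
    by (simp_all add: scaleC_of_real [symmetric] cinner_scaleC_left cinner_scaleC_right
        scaleR_conv_of_real)
  show "\<exists>K. \<forall>x y :: 'a. cmod (cinner x y) \<le> norm x * norm y * K"
    using norm_cinner_le by (metis mult.right_neutral)
qed (simp_all add: cinner_add_left cinner_add_right)

lemma bounded_linear_scaleC: "bounded_linear (\<lambda>x :: 'a::complex_hilbert_space. c *\<^sub>C x)"
proof
  show "c *\<^sub>C r *\<^sub>R x = r *\<^sub>R c *\<^sub>C x" for r and x :: 'a
    by (simp add: scaleC_of_real [symmetric] scaleC_scaleC mult.commute)
  show "\<exists>K. \<forall>x :: 'a. norm (c *\<^sub>C x) \<le> norm x * K"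
    by (metis norm_scaleC mult.commute order_refl)
qed (rule scaleC_add_right)

section \<open>Unitary maps and self-adjoint operators\<close>

lemma unitary_norm: "unitary u \<Longrightarrow> norm (u x) = norm x"
  unfolding unitary_def
  by (metis cinner_self norm_ge_zero of_real_eq_iff power2_eq_iff_nonneg)

lemma unitary_sum_scaleC:
  assumes "unitary u"
  shows "u (\<Sum>j\<in>A. a j *\<^sub>C x j) = (\<Sum>j\<in>A. a j *\<^sub>C u (x j))"
proof -
  have "Modules.additive u"
    using assms by (simp add: unitary_def Modules.additive_def)
  then show ?thesis
    using assms by (simp add: additive.sum unitary_def)
qed

text \<open>Since \<open>A\<close> is its own adjoint, \<open>the (A y)\<close> is the vector picked
  by \<open>THE\<close> in \<open>adjoint_operator\<close>; density of the domain makes that choice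
  unique, so it has the defining property.\<close>

lemma self_adjoint_symmetric:
  assumes A: "self_adjoint A" and "x \<in> dom A" "y \<in> dom A"
  shows "cinner y (the (A x)) = cinner (the (A y)) x"
proof -
  let ?P = "\<lambda>z. \<forall>x\<in>dom A. cinner y (the (A x)) = cinner z x"
  have adj: "adjoint_operator A = A" and dense: "closure (dom A) = UNIV"
    using A by (auto simp: self_adjoint_def)
  have "adjoint_operator A y \<noteq> None"
    using adj \<open>y \<in> dom A\<close> by auto
  then have ex: "\<exists>z. ?P z"
    by (auto simp: adjoint_operator_def split: if_splits)
  have unique: "z = z'" if "?P z" "?P z'" for z z'
  proof -
    \<comment> \<open>The difference of two candidates is orthogonal to a dense set, hence by
      continuity to every vector, in particular to itself.\<close>
    have "continuous_on (closure (dom A)) (\<lambda>x. cinner (z - z') x)"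
      by (intro bounded_bilinear.continuous_on [OF bounded_bilinear_cinner] continuous_intros)
    moreover have "cinner (z - z') x = 0" if "x \<in> dom A" for x
      using \<open>?P z\<close> \<open>?P z'\<close> that by (simp add: bounded_bilinear.diff_left [OF bounded_bilinear_cinner])
    ultimately have "cinner (z - z') (z - z') = 0"
      using continuous_constant_on_closure [of "dom A" "\<lambda>x. cinner (z - z') x" 0 "z - z'"] dense
      by simp
    then show ?thesis
      by (simp add: cinner_self)
  qed
  obtain z where "?P z"
    using ex by blast
  then have "?P (THE z. ?P z)"
    by (rule theI [of ?P]) (use \<open>?P z\<close> unique in blast)
  moreover have "adjoint_operator A y = Some (THE z. ?P z)"
    using ex by (simp add: adjoint_operator_def)
  ultimately show ?thesis
    using adj \<open>x \<in> dom A\<close> by simp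
qed

section \<open>Schroedinger solutions: uniqueness and time shift\<close>

lemma schroedinger_solution_has_vector_derivative:
  assumes "schroedinger_solution H \<phi>"
  shows "(\<phi> has_vector_derivative - \<i> *\<^sub>C the (H t (\<phi> t))) (at t)"
proof -
  have "- \<i> *\<^sub>C the (H t (\<phi> t)) = - \<i> *\<^sub>C \<i> *\<^sub>C vector_derivative \<phi> (at t)"
    using assms by (simp add: schroedinger_solution_def)
  also have "\<dots> = vector_derivative \<phi> (at t)"
    by (simp only: scaleC_scaleC) simp
  finally show ?thesis
    using assms by (simp add: schroedinger_solution_def vector_derivative_works)
qed

lemma schroedinger_solution_unique:
  assumes H: "\<And>t. self_adjoint (H t)"
    and \<phi>: "schroedinger_solution H \<phi>" and \<eta>: "schroedinger_solution H \<eta>" and "\<phi> 0 = \<eta> 0"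
  shows "\<phi> t = \<eta> t"
proof -
  define \<delta> where "\<delta> t = \<phi> t - \<eta> t" for t
  have "((\<lambda>t. cinner (\<delta> t) (\<delta> t)) has_vector_derivative 0) (at t)" for t
  proof -
    have dom: "\<phi> t \<in> dom (H t)" "\<eta> t \<in> dom (H t)"
      using \<phi> \<eta> by (auto simp: schroedinger_solution_def)
    have lin: "linear_operator (H t)"
      using H by (simp add: self_adjoint_def)
    have dom_\<delta>: "\<delta> t \<in> dom (H t)"
      using lin dom complex_vector.subspace_diff unfolding linear_operator_def \<delta>_def by blast
    \<comment> \<open>\<open>linear_operator\<close> speaks of sums within the domain, so the
      difference is treated through \<phi> = \<delta> + \<eta>.\<close>
    have "the (H t (\<delta> t + \<eta> t)) = the (H t (\<delta> t)) + the (H t (\<eta> t))"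
      using lin dom(2) dom_\<delta> unfolding linear_operator_def by blast
    then have "the (H t (\<delta> t)) = the (H t (\<phi> t)) - the (H t (\<eta> t))"
      by (simp add: \<delta>_def)
    moreover have "(\<delta> has_vector_derivative
        - \<i> *\<^sub>C the (H t (\<phi> t)) - - \<i> *\<^sub>C the (H t (\<eta> t))) (at t)"
      unfolding \<delta>_def
      by (intro has_vector_derivative_diff schroedinger_solution_has_vector_derivative \<phi> \<eta>)
    ultimately have "(\<delta> has_vector_derivative - \<i> *\<^sub>C the (H t (\<delta> t))) (at t)"
      by (simp add: complex_vector.scale_right_diff_distrib)
    \<comment> \<open>The product rule yields -i\<langle>\<delta>, H\<delta>\<rangle> +
      i\<langle>H\<delta>, \<delta>\<rangle>, the second sign coming from conjugate linearity;
      symmetry of H(t) cancels the two terms.\<close>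
    from bounded_bilinear.has_vector_derivative [OF bounded_bilinear_cinner this this]
    show ?thesis
      using self_adjoint_symmetric [OF H dom_\<delta> dom_\<delta>]
      by (simp only: cinner_scaleC_left cinner_scaleC_right) simp
  qed
  then obtain k where k: "\<And>t. cinner (\<delta> t) (\<delta> t) = k"
    using has_vector_derivative_zero_constant [of UNIV "\<lambda>t. cinner (\<delta> t) (\<delta> t)"] by auto
  have "cinner (\<delta> t) (\<delta> t) = cinner (\<delta> 0) (\<delta> 0)"
    by (simp only: k)
  then show ?thesis
    using \<open>\<phi> 0 = \<eta> 0\<close> by (simp add: \<delta>_def cinner_self)
qed

lemma schroedinger_solution_shift:
  assumes \<phi>: "schroedinger_solution H \<phi>" and per: "\<And>t. H (t + T) = H t"
  shows "schroedinger_solution H (\<lambda>t. \<phi> (t + T))"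
  unfolding schroedinger_solution_def
proof (intro allI conjI)
  fix t
  show "\<phi> (t + T) \<in> dom (H t)"
    using \<phi> per [of t] unfolding schroedinger_solution_def by metis
  have "((\<lambda>t. \<phi> (t + T)) has_vector_derivative vector_derivative \<phi> (at (t + T))) (at t)"
  proof -
    have "(\<phi> has_vector_derivative vector_derivative \<phi> (at (t + T))) (at (t + T))"
      using \<phi> by (simp add: schroedinger_solution_def vector_derivative_works)
    moreover have "((\<lambda>t. t + T) has_vector_derivative 1) (at t)"
      by (auto intro!: derivative_eq_intros)
    ultimately show ?thesis
      using vector_diff_chain_at [of "\<lambda>t. t + T" 1 t \<phi>] by (simp add: o_def)
  qed
  then have "(\<lambda>t. \<phi> (t + T)) differentiable (at t)"
    and "vector_derivative (\<lambda>t. \<phi> (t + T)) (at t) = vector_derivative \<phi> (at (t + T))"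
    by (auto intro: differentiableI_vector vector_derivative_at)
  then show "(\<lambda>t. \<phi> (t + T)) differentiable (at t)"
    and "\<i> *\<^sub>C vector_derivative (\<lambda>t. \<phi> (t + T)) (at t) = the (H t (\<phi> (t + T)))"
    using \<phi> per [of t] by (auto simp: schroedinger_solution_def)
qed

section \<open>Periodicity and Floquet eigenvectors\<close>

lemma bounded_periodic:
  fixes g :: "real \<Rightarrow> real"
  assumes cont: "continuous_on UNIV g" and "T > 0" and per: "\<And>t. g (t + T) = g t"
  shows "bounded (range g)"
proof -
  have per_nat: "g (t + real n * T) = g t" for t n
  proof (induction n)
    case (Suc n)
    then show ?case
      using per [of "t + real n * T"] by (simp add: algebra_simps)
  qed simp
  have per_int: "g (t + of_int k * T) = g t" for t k
  proof (cases k rule: int_cases2)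
    case (nonneg n)
    then show ?thesis using per_nat by simp
  next
    case (nonpos n)
    \<comment> \<open>A negative shift is undone by starting n periods earlier and moving
      forward.\<close>
    then show ?thesis using per_nat [of "t - real n * T" n] by simp
  qed
  \<comment> \<open>Subtracting the integer part of t / T periods moves t into one period, whose
    image is compact.\<close>
  have "g t \<in> g ` {0..T}" for t
  proof
    let ?k = "\<lfloor>t / T\<rfloor>"
    show "g t = g (t + of_int (- ?k) * T)"
      by (rule per_int [symmetric])
    show "t + of_int (- ?k) * T \<in> {0..T}"
      using \<open>T > 0\<close> floor_divide_lower [of T t] floor_divide_upper [of T t]
      by (auto simp: algebra_simps)
  qed
  moreover have "bounded (g ` {0..T})"
    by (intro compact_imp_bounded compact_continuous_image continuous_on_subset [OF cont]) auto
  ultimately show ?thesis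
    by (meson bounded_subset image_subsetI)
qed

lemma floquet_eigenvector_quasiperiodic:
  assumes H: "\<And>t. self_adjoint (H t)" and per: "\<And>t. H (t + T) = H t"
    and U: "propagator H D U" and "complex_vector.subspace D"
    and "\<xi> \<in> D" and \<xi>: "U T 0 \<xi> = c *\<^sub>C \<xi>"
  shows "U (t + T) 0 \<xi> = c *\<^sub>C U t 0 \<xi>"
proof -
  have sol: "schroedinger_solution H (\<lambda>t. U t 0 x)" if "x \<in> D" for x
    using U that by (simp add: propagator_def)
  \<comment> \<open>Needed so that the Schroedinger equation also holds for the solution starting at
    c\<xi>, against which the shifted one is compared.\<close>
  have "c *\<^sub>C \<xi> \<in> D"
    using \<open>complex_vector.subspace D\<close> \<open>\<xi> \<in> D\<close> by (rule complex_vector.subspace_scale)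
  moreover have "U 0 0 = id"
    using U unfolding propagator_def by blast
  ultimately have "U (t + T) 0 \<xi> = U t 0 (c *\<^sub>C \<xi>)"
    using schroedinger_solution_unique
      [OF H schroedinger_solution_shift [OF sol [OF \<open>\<xi> \<in> D\<close>] per] sol [OF \<open>c *\<^sub>C \<xi> \<in> D\<close>]] \<xi>
    by simp
  then show ?thesis
    using U by (simp add: propagator_def unitary_def)
qed

lemma floquet_eigenvector_derivative_bounded:
  assumes H: "\<And>t. self_adjoint (H t)" and per: "\<And>t. H (t + T) = H t" and "T > 0"
    and U: "propagator H D U" and "complex_vector.subspace D"
    and "\<xi> \<in> D" and \<xi>: "eigenvector (U T 0) \<xi>"
    and der: "\<And>t. ((\<lambda>t. U t 0 \<xi>) has_vector_derivative d t) (at t)"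
    and cont: "continuous_on UNIV d"
  shows "bounded (range d)"
proof -
  obtain c where c: "U T 0 \<xi> = c *\<^sub>C \<xi>" and "\<xi> \<noteq> 0"
    using \<xi> by (auto simp: eigenvector_def)
  have "norm (U T 0 \<xi>) = norm \<xi>"
    using U by (simp add: propagator_def unitary_norm)
  then have "cmod c = 1"
    using c \<open>\<xi> \<noteq> 0\<close> by (simp add: norm_scaleC)
  \<comment> \<open>Both sides are derivatives at t of the same curve: one by the chain rule, the
    other by quasiperiodicity.\<close>
  have "d (t + T) = c *\<^sub>C d t" for t
  proof (rule vector_derivative_unique_at)
    have "((\<lambda>t. t + T) has_vector_derivative 1) (at t)"
      by (auto intro!: derivative_eq_intros)
    from vector_diff_chain_at [OF this der]
    show "((\<lambda>t. U (t + T) 0 \<xi>) has_vector_derivative d (t + T)) (at t)"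
      by (simp add: o_def)
    show "((\<lambda>t. U (t + T) 0 \<xi>) has_vector_derivative c *\<^sub>C d t) (at t)"
      unfolding floquet_eigenvector_quasiperiodic
        [OF H per U \<open>complex_vector.subspace D\<close> \<open>\<xi> \<in> D\<close> c]
      by (rule bounded_linear.has_vector_derivative [OF bounded_linear_scaleC der])
  qed
  \<comment> \<open>The derivative repeats only up to the factor c; taking norms removes this factor
    and gives a truly periodic function.\<close>
  then have "bounded (range (\<lambda>t. norm (d t)))"
    using \<open>cmod c = 1\<close> \<open>T > 0\<close> cont
    by (intro bounded_periodic [of _ T] continuous_intros) (simp_all add: norm_scaleC)
  then show ?thesis
    by (auto simp: bounded_iff)
qed

section \<open>Energy bounds for superpositions of Floquet eigenvectors\<close>

theorem proposition7:
  fixes H\<^sub>0 :: "'a::complex_hilbert_space operator"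
    and V H :: "real \<Rightarrow> 'a operator"
    and U :: "real \<Rightarrow> real \<Rightarrow> 'a \<Rightarrow> 'a"
    and T :: real
    and n :: nat
    and \<xi> :: "nat \<Rightarrow> 'a"
    and a :: "nat \<Rightarrow> complex"
    and \<psi> :: 'a
  assumes "separable_space (euclidean :: 'a topology)"
    and "probe_operator U H\<^sub>0"
    and "\<And>t. linear_operator (V t)"
    and "\<And>t. H t = operator_sum H\<^sub>0 (V t)"
    and "\<And>t. self_adjoint (H t)"
    and "T > 0" and "\<And>t. V (t + T) = V t"
    and "propagator H (dom H\<^sub>0) U"
    and "\<And>j. j \<in> {1..n} \<Longrightarrow> eigenvector (U T 0) (\<xi> j) \<and> \<xi> j \<in> dom H\<^sub>0"
    and "\<And>j. j \<in> {1..n} \<Longrightarrow> (\<lambda>t. U t 0 (\<xi> j)) C1_differentiable_on UNIV"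
    and "\<psi> = (\<Sum>j=1..n. a j *\<^sub>C \<xi> j)"
  shows "bounded (range (energy U H \<psi>)) \<and>
    ((\<forall>t. everywhere_bounded (V t)) \<and> bdd_above (range (\<lambda>t. onorm (\<lambda>x. the (V t x)))) \<longrightarrow>
      bounded (range (energy U (\<lambda>t. H\<^sub>0) \<psi>)))"
proof -
  let ?D = "dom H\<^sub>0"
  let ?\<psi> = "\<lambda>t. U t 0 \<psi>"
  have subspace: "complex_vector.subspace ?D"
    using assms(2) by (simp add: probe_operator_def self_adjoint_def linear_operator_def)
  have per: "H (t + T) = H t" for t
    by (simp only: assms(4,7))
  have unitary: "unitary (U t s)" for t s
    using assms(8) by (simp add: propagator_def)
  have norm_\<psi>: "norm (?\<psi> t) = norm \<psi>" for t
    by (rule unitary_norm [OF unitary])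
  have "\<psi> \<in> ?D"
    unfolding assms(11)
    using assms(9) by (intro complex_vector.subspace_sum complex_vector.subspace_scale subspace) auto
  then have sol: "schroedinger_solution H ?\<psi>"
    using assms(8) by (simp add: propagator_def)
  have "\<forall>j\<in>{1..n}. \<exists>d. (\<forall>t. ((\<lambda>t. U t 0 (\<xi> j)) has_vector_derivative d t) (at t)) \<and>
      continuous_on UNIV d"
    using assms(10) by (simp add: C1_differentiable_on_def)
  then obtain d where d: "\<And>j t. j \<in> {1..n} \<Longrightarrow>
        ((\<lambda>t. U t 0 (\<xi> j)) has_vector_derivative d j t) (at t)"
      and cont: "\<And>j. j \<in> {1..n} \<Longrightarrow> continuous_on UNIV (d j)"
    by metis
  have "\<exists>B. \<forall>t. norm (d j t) \<le> B" if "j \<in> {1..n}" for j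
    using floquet_eigenvector_derivative_bounded
      [OF assms(5) per assms(6,8) subspace _ _ d cont, of j] assms(9) that
    by (auto simp: bounded_iff)
  then obtain B where B: "\<And>j t. j \<in> {1..n} \<Longrightarrow> norm (d j t) \<le> B j"
    by metis
  \<comment> \<open>H(t)\<psi>(t) has the same norm as \<psi>'(t), which is the superposition of the
    bounded derivatives of the eigenvector orbits. Thus the bound does not depend on t.\<close>
  have H\<psi>: "norm (the (H t (?\<psi> t))) \<le> (\<Sum>j=1..n. cmod (a j) * B j)" for t
  proof -
    have "(?\<psi> has_vector_derivative (\<Sum>j=1..n. a j *\<^sub>C d j t)) (at t)"
      unfolding assms(11) unitary_sum_scaleC [OF unitary]
      using d by (intro has_vector_derivative_sum
          bounded_linear.has_vector_derivative [OF bounded_linear_scaleC]) auto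
    \<comment> \<open>The Schroedinger equation and termwise differentiation give two expressions
      for \<psi>'(t).\<close>
    then have "- \<i> *\<^sub>C the (H t (?\<psi> t)) = (\<Sum>j=1..n. a j *\<^sub>C d j t)"
      by (rule vector_derivative_unique_at [OF schroedinger_solution_has_vector_derivative [OF sol]])
    then have "norm (- \<i> *\<^sub>C the (H t (?\<psi> t))) = norm (\<Sum>j=1..n. a j *\<^sub>C d j t)"
      by (rule arg_cong)
    then have "norm (the (H t (?\<psi> t))) = norm (\<Sum>j=1..n. a j *\<^sub>C d j t)"
      by (simp only: norm_scaleC) simp
    also have "\<dots> \<le> (\<Sum>j=1..n. cmod (a j) * B j)"
      using B by (intro sum_norm_le) (simp add: norm_scaleC mult_left_mono)
    finally show ?thesis .
  qed
  let ?E = "norm \<psi> * (\<Sum>j=1..n. cmod (a j) * B j)"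
  have E: "cmod (energy U H \<psi> t) \<le> ?E" for t
  proof -
    have "cmod (energy U H \<psi> t) \<le> norm \<psi> * norm (the (H t (?\<psi> t)))"
      using norm_cinner_le [of "?\<psi> t"] by (simp add: energy_def norm_\<psi>)
    also have "\<dots> \<le> ?E"
      by (intro mult_left_mono H\<psi> norm_ge_zero)
    finally show ?thesis .
  qed
  show ?thesis
  proof (intro conjI impI)
    show "bounded (range (energy U H \<psi>))"
      using E by (auto simp: bounded_iff)
    assume "(\<forall>t. everywhere_bounded (V t)) \<and> bdd_above (range (\<lambda>t. onorm (\<lambda>x. the (V t x))))"
    \<comment> \<open>Bounded linearity is kept along with the bound M, because \<open>onorm\<close>
      controls the values V(t)x only for bounded linear maps.\<close>
    then obtain M where bl: "\<And>t. bounded_linear (\<lambda>x. the (V t x))"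
        and M: "\<And>t. onorm (\<lambda>x. the (V t x)) \<le> M"
      by (auto simp: everywhere_bounded_def bdd_above_def)
    have "cmod (energy U (\<lambda>t. H\<^sub>0) \<psi> t) \<le> ?E + norm \<psi> * (M * norm \<psi>)" for t
    proof -
      have "?\<psi> t \<in> dom (H t)"
        using sol by (simp add: schroedinger_solution_def)
      \<comment> \<open>The domain of H(t) is the intersection of the two domains, so the solution
        lies in both and the value splits.\<close>
      then have "the (H t (?\<psi> t)) = the (H\<^sub>0 (?\<psi> t)) + the (V t (?\<psi> t))"
        by (auto simp: assms(4) operator_sum_def split: if_splits)
      then have "energy U H \<psi> t = energy U (\<lambda>t. H\<^sub>0) \<psi> t + energy U V \<psi> t"
        by (simp add: energy_def cinner_add_right)
      then have "cmod (energy U (\<lambda>t. H\<^sub>0) \<psi> t) \<le> cmod (energy U H \<psi> t) + cmod (energy U V \<psi> t)"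
        by (metis add_diff_cancel_right' norm_triangle_ineq4)
      moreover have "cmod (energy U V \<psi> t) \<le> norm \<psi> * (M * norm \<psi>)"
      proof -
        have "cmod (energy U V \<psi> t) \<le> norm \<psi> * norm (the (V t (?\<psi> t)))"
          using norm_cinner_le [of "?\<psi> t"] by (simp add: energy_def norm_\<psi>)
        also have "norm (the (V t (?\<psi> t))) \<le> onorm (\<lambda>x. the (V t x)) * norm \<psi>"
          using onorm [OF bl, of t "?\<psi> t"] by (simp add: norm_\<psi>)
        also have "\<dots> \<le> M * norm \<psi>"
          by (intro mult_right_mono M norm_ge_zero)
        finally show ?thesis
          by (simp add: mult_left_mono)
      qed
      ultimately show ?thesis
        using E [of t] by linarith
    qed
    then show "bounded (range (energy U (\<lambda>t. H\<^sub>0) \<psi>))"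
      by (auto simp: bounded_iff)
  qed
qed

end
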